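(* Let $N=\{1,\ldots,n\}$ and let a submodular function $f:2^N\to\mathbb{R}$ and vectors $a \in \mathbb{R}^n_{>0}$ and $b \in \mathbb{R}^n$ be given. (i) Any least $(a,b)$-majorized element of $B(f)$ is also a least weakly $(a,b)$-supermajorized element of $P(f)$ and a least weakly $(a,b)$-submajorized element of $P_{\text{sup}}(f^{\#})$. (ii) If $f$ and $b$ are integral, then any least $(1,b)$-majorized element of $B^{\mathbb{Z}}(f)$ is also a least weakly $(1,b)$-supermajorized element of $P^{\mathbb{Z}}(f)$ and a least weakly $(1,b)$-submajorized element of $P^{\mathbb{Z}}_{\text{sup}}(f^{\#})$.
   Context: Notation: $x(A) := \sum_{i\in A} x_i$ for $x\in\mathbb{R}^n$, $A\subseteq N$; in "$(1,b)$", $1$ is the all-ones vector; "integral" means integer-valued. $f:2^N\to\mathbb{R}$ with $f(\emptyset)=0$ is submodular if $f(A)+f(B)\ge f(A\cup B)+f(A\cap B)$ for all $A,B\subseteq N$; $g$ is supermodular if $-g$ is submodular. The dual supermodular function of $f$ is $f^{\#}(A):=f(N)-f(N\setminus A)$. Define $P(f):=\{x\in\mathbb{R}^n : x(A)\le f(A)\ \forall A\subseteq N\}$, $B(f):=\{x\in P(f): x(N)=f(N)\}$, $P_{\text{sup}}(g):=\{x\in\mathbb{R}^n : x(A)\ge g(A)\ \forall A\subseteq N\}$, and let $P^{\mathbb{Z}}(f)$, $B^{\mathbb{Z}}(f)$, $P^{\mathbb{Z}}_{\text{sup}}(g)$ be the intersections of these sets with $\mathbb{Z}^n$. Majorization: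 for $a\in\mathbb{R}^n_{>0}$, $b\in\mathbb{R}^n$ and $x,y\in\mathbb{R}^n$, consider the inequality $\sum_{i\in N} a_i\phi\left(\frac{x_i+b_i}{a_i}\right)\le \sum_{i\in N} a_i\phi\left(\frac{y_i+b_i}{a_i}\right)$ ( * ). Then $x$ is $(a,b)$-majorized by $y$ if $x(N)=y(N)$ and ( * ) holds for all continuous convex $\phi:\mathbb{R}\to\mathbb{R}$; weakly $(a,b)$-submajorized (resp. weakly $(a,b)$-supermajorized) by $y$ if ( * ) holds for all non-decreasing (resp. non-increasing) continuous convex $\phi$. For $C\subseteq\mathbb{R}^n$, $x\in C$ is a least $(a,b)$-majorized (resp. least weakly $(a,b)$-submajorized, least weakly $(a,b)$-supermajorized) element of $C$ if it is so majorized by every $y\in C$. *)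

theory Defs
  imports "HOL-Analysis.Analysis"
begin

text \<open>The ground set \<open>N = {1, \<dots>, n}\<close> is the universe of a finite index type \<open>'n\<close>, so that
  set functions are defined on all of \<open>'n set\<close> and the complement \<open>- A\<close> is \<open>N \<setminus> A\<close>.\<close>

definition vsum :: "real ^ 'n \<Rightarrow> 'n::finite set \<Rightarrow> real" where
  "vsum x A = (\<Sum>i\<in>A. x $ i)"

definition submodular :: "('n::finite set \<Rightarrow> real) \<Rightarrow> bool" where
  "submodular f \<longleftrightarrow> f {} = 0 \<and> (\<forall>A B. f A + f B \<ge> f (A \<union> B) + f (A \<inter> B))"

definition dual_fun :: "('n::finite set \<Rightarrow> real) \<Rightarrow> 'n set \<Rightarrow> real" where
  "dual_fun f A = f UNIV - f (- A)"

definition sub_poly :: "('n::finite set \<Rightarrow> real) \<Rightarrow> (real ^ 'n) set" where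
  "sub_poly f = {x. \<forall>A. vsum x A \<le> f A}"

definition base_poly :: "('n::finite set \<Rightarrow> real) \<Rightarrow> (real ^ 'n) set" where
  "base_poly f = {x \<in> sub_poly f. vsum x UNIV = f UNIV}"

definition sup_poly :: "('n::finite set \<Rightarrow> real) \<Rightarrow> (real ^ 'n) set" where
  "sup_poly g = {x. \<forall>A. vsum x A \<ge> g A}"

definition int_vecs :: "(real ^ 'n::finite) set" where
  "int_vecs = {x. \<forall>i. x $ i \<in> \<int>}"

definition int_sub_poly :: "('n::finite set \<Rightarrow> real) \<Rightarrow> (real ^ 'n) set" where
  "int_sub_poly f = sub_poly f \<inter> int_vecs"

definition int_base_poly :: "('n::finite set \<Rightarrow> real) \<Rightarrow> (real ^ 'n) set" where
  "int_base_poly f = base_poly f \<inter> int_vecs"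

definition int_sup_poly :: "('n::finite set \<Rightarrow> real) \<Rightarrow> (real ^ 'n) set" where
  "int_sup_poly g = sup_poly g \<inter> int_vecs"

text \<open>The majorization notions below are meant for weights \<open>a\<close> with all components positive.\<close>

definition major_sum :: "real ^ 'n \<Rightarrow> real ^ 'n \<Rightarrow> (real \<Rightarrow> real) \<Rightarrow> real ^ 'n::finite \<Rightarrow> real" where
  "major_sum a b \<phi> x = (\<Sum>i\<in>UNIV. a $ i * \<phi> ((x $ i + b $ i) / a $ i))"

definition majorized ::
    "real ^ 'n \<Rightarrow> real ^ 'n \<Rightarrow> real ^ 'n \<Rightarrow> real ^ 'n::finite \<Rightarrow> bool" where
  "majorized a b x y \<longleftrightarrow> vsum x UNIV = vsum y UNIV \<and>
     (\<forall>\<phi>. continuous_on UNIV \<phi> \<and> convex_on UNIV \<phi> \<longrightarrow> major_sum a b \<phi> x \<le> major_sum a b \<phi> y)"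

definition weakly_submajorized ::
    "real ^ 'n \<Rightarrow> real ^ 'n \<Rightarrow> real ^ 'n \<Rightarrow> real ^ 'n::finite \<Rightarrow> bool" where
  "weakly_submajorized a b x y \<longleftrightarrow>
     (\<forall>\<phi>. mono \<phi> \<and> continuous_on UNIV \<phi> \<and> convex_on UNIV \<phi> \<longrightarrow>
        major_sum a b \<phi> x \<le> major_sum a b \<phi> y)"

definition weakly_supermajorized ::
    "real ^ 'n \<Rightarrow> real ^ 'n \<Rightarrow> real ^ 'n \<Rightarrow> real ^ 'n::finite \<Rightarrow> bool" where
  "weakly_supermajorized a b x y \<longleftrightarrow>
     (\<forall>\<phi>. antimono \<phi> \<and> continuous_on UNIV \<phi> \<and> convex_on UNIV \<phi> \<longrightarrow>
        major_sum a b \<phi> x \<le> major_sum a b \<phi> y)"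

definition least_majorized ::
    "real ^ 'n \<Rightarrow> real ^ 'n \<Rightarrow> (real ^ 'n) set \<Rightarrow> real ^ 'n::finite \<Rightarrow> bool" where
  "least_majorized a b C x \<longleftrightarrow> x \<in> C \<and> (\<forall>y\<in>C. majorized a b x y)"

definition least_weakly_submajorized ::
    "real ^ 'n \<Rightarrow> real ^ 'n \<Rightarrow> (real ^ 'n) set \<Rightarrow> real ^ 'n::finite \<Rightarrow> bool" where
  "least_weakly_submajorized a b C x \<longleftrightarrow> x \<in> C \<and> (\<forall>y\<in>C. weakly_submajorized a b x y)"

definition least_weakly_supermajorized ::
    "real ^ 'n \<Rightarrow> real ^ 'n \<Rightarrow> (real ^ 'n) set \<Rightarrow> real ^ 'n::finite \<Rightarrow> bool" where
  "least_weakly_supermajorized a b C x \<longleftrightarrow> x \<in> C \<and> (\<forall>y\<in>C. weakly_supermajorized a b x y)"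

end

theory Submission
  imports Defs
begin

text \<open>
  Every \<open>y\<close> in \<open>P(f)\<close> lies below some base \<open>z\<close>: raise the coordinates of \<open>y\<close> one after the
  other until each of them lies in a tight set; tight sets are closed under union, so that \<open>N\<close>
  itself becomes tight. If \<open>f\<close> and \<open>y\<close> are integral, so are all the increments. For a
  non-increasing \<open>\<phi>\<close> the sum at \<open>z\<close> is at most the sum at \<open>y\<close>, and the sum at a least majorized
  base is at most the sum at \<open>z\<close>. The claim on \<open>P\<^sub>s\<^sub>u\<^sub>p\<close> follows by applying the same argument to
  \<open>- y\<close> and the submodular function \<open>- f\<^sup>#\<close>, whose bases are the negatives of the bases of \<open>f\<close>.
\<close>

lemma vsum_uminus: "vsum (- x) A = - vsum x A"
  by (simp add: vsum_def sum_negf)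

lemma vsum_mono: "x \<le> y \<Longrightarrow> vsum x A \<le> vsum y A"
  by (simp add: vsum_def less_eq_vec_def sum_mono)

lemma vsum_Un_Int: "vsum x (A \<union> B) + vsum x (A \<inter> B) = vsum x A + vsum x B"
  by (simp add: vsum_def sum.union_inter)

lemma vsum_Compl: "vsum x (- A) = vsum x UNIV - vsum x A"
proof -
  have "vsum x (A \<union> - A) + vsum x (A \<inter> - A) = vsum x A + vsum x (- A)"
    by (rule vsum_Un_Int)
  then show ?thesis
    by (simp add: vsum_def)
qed

lemma vsum_add_axis: "vsum (x + axis i d) A = vsum x A + (if i \<in> A then d else 0)"
  by (simp add: vsum_def axis_def sum.distrib sum.delta)

lemma vsum_in_Ints: "x \<in> int_vecs \<Longrightarrow> vsum x A \<in> \<int>"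
  by (simp add: vsum_def int_vecs_def Ints_sum)

lemma uminus_in_int_vecs: "x \<in> int_vecs \<Longrightarrow> - x \<in> int_vecs"
  by (simp add: int_vecs_def)

text \<open>The increment is the least slack \<open>f A - vsum y A\<close> among the sets containing
  \<open>i\<close>. Sets without \<open>i\<close> are unaffected by it, and a set attaining the
  minimum becomes tight. For integral data this slack is an integer.\<close>

lemma sub_poly_raise_coordinate:
  fixes f :: "'n::finite set \<Rightarrow> real"
  assumes "y \<in> sub_poly f"
  obtains z A where "z \<in> sub_poly f" "y \<le> z" "i \<in> A" "vsum z A = f A"
    "(\<forall>A. f A \<in> \<int>) \<Longrightarrow> y \<in> int_vecs \<Longrightarrow> z \<in> int_vecs"
proof -
  define D where "D = (\<lambda>A. f A - vsum y A) ` {A. i \<in> A}"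
  define d where "d = Min D"
  have D: "finite D" "D \<noteq> {}"
    by (auto simp: D_def)
  have "d \<in> D"
    unfolding d_def using D by (rule Min_in)
  then obtain A where A: "i \<in> A" "d = f A - vsum y A"
    by (auto simp: D_def)
  have d_le: "d \<le> f B - vsum y B" if "i \<in> B" for B
    unfolding d_def using D that by (intro Min_le) (auto simp: D_def)
  have y: "vsum y B \<le> f B" for B
    using assms by (simp add: sub_poly_def)
  show thesis
  proof (rule that[of "y + axis i d" A])
    show "y + axis i d \<in> sub_poly f"
      using y d_le by (force simp: sub_poly_def vsum_add_axis)
    \<comment> \<open>Here \<open>d \<ge> 0\<close>, being the slack at \<open>A\<close> of a vector
      in \<open>sub_poly f\<close>.\<close>
    show "y \<le> y + axis i d"
      using A y[of A] by (simp add: less_eq_vec_def axis_def)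
    show "vsum (y + axis i d) A = f A"
      using A by (simp add: vsum_add_axis)
    show "y + axis i d \<in> int_vecs" if "\<forall>A. f A \<in> \<int>" "y \<in> int_vecs"
    proof -
      have "d \<in> \<int>"
        using A that vsum_in_Ints by simp
      then show ?thesis
        using that by (simp add: int_vecs_def axis_def)
    qed
  qed (fact A)
qed

text \<open>Integrality is carried as an implication in the conclusion, so that a single induction
  over the coordinates serves the real and the integral case.\<close>

lemma sub_poly_raise_coordinates:
  fixes f :: "'n::finite set \<Rightarrow> real"
  assumes "y \<in> sub_poly f"
  shows "\<exists>z \<in> sub_poly f. y \<le> z \<and> (\<forall>i\<in>S. \<exists>A. i \<in> A \<and> vsum z A = f A) \<and>
    ((\<forall>A. f A \<in> \<int>) \<and> y \<in> int_vecs \<longrightarrow> z \<in> int_vecs)"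
  using finite[of S]
proof (induction S)
  case empty
  show ?case
    using assms by auto
next
  case (insert i S)
  then obtain z where z: "z \<in> sub_poly f" "y \<le> z" "\<forall>i\<in>S. \<exists>A. i \<in> A \<and> vsum z A = f A"
    "(\<forall>A. f A \<in> \<int>) \<and> y \<in> int_vecs \<longrightarrow> z \<in> int_vecs"
    by blast
  obtain w A where w: "w \<in> sub_poly f" "z \<le> w" "i \<in> A" "vsum w A = f A"
    "(\<forall>A. f A \<in> \<int>) \<Longrightarrow> z \<in> int_vecs \<Longrightarrow> w \<in> int_vecs"
    using sub_poly_raise_coordinate[OF z(1)] by metis
  \<comment> \<open>Tight sets survive later raises:
    \<open>f B = vsum z B \<le> vsum w B \<le> f B\<close>.\<close>
  have "vsum w B = f B" if "vsum z B = f B" for B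
    using vsum_mono[OF w(2), of B] w(1) that by (simp add: sub_poly_def order_antisym)
  with z(3) w(3,4) have "\<forall>j\<in>insert i S. \<exists>A. j \<in> A \<and> vsum w A = f A"
    by blast
  then show ?case
    using w z order_trans[OF z(2) w(2)] by blast
qed

text \<open>The slacks of union and intersection are nonnegative, and by submodularity their sum is
  at most the sum of the slacks of \<open>A\<close> and \<open>B\<close>, which is zero.\<close>

lemma tight_Un:
  assumes "submodular f" "x \<in> sub_poly f" "vsum x A = f A" "vsum x B = f B"
  shows "vsum x (A \<union> B) = f (A \<union> B)"
proof -
  have "vsum x (A \<union> B) \<le> f (A \<union> B)" "vsum x (A \<inter> B) \<le> f (A \<inter> B)"
    using assms(2) by (simp_all add: sub_poly_def)
  moreover have "f (A \<union> B) + f (A \<inter> B) \<le> f A + f B"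
    using assms(1) by (simp add: submodular_def)
  ultimately show ?thesis
    using vsum_Un_Int[of x A B] assms(3,4) by linarith
qed

lemma tight_UNIV:
  fixes f :: "'n::finite set \<Rightarrow> real"
  assumes "submodular f" "x \<in> sub_poly f" "\<forall>i. \<exists>A. i \<in> A \<and> vsum x A = f A"
  shows "vsum x UNIV = f UNIV"
proof -
  obtain T where T: "\<And>i. i \<in> T i" "\<And>i. vsum x (T i) = f (T i)"
    using assms(3) by metis
  \<comment> \<open>Closure under binary unions gives finite ones; the empty union is tight because
    \<open>f {} = 0\<close>.\<close>
  have "vsum x (\<Union>i\<in>S. T i) = f (\<Union>i\<in>S. T i)" for S
    using finite[of S]
  proof (induction S)
    case empty
    show ?case
      using assms(1) by (simp add: vsum_def submodular_def)
  next
    case (insert i S)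
    then show ?case
      using tight_Un[OF assms(1,2) T(2)] by simp
  qed
  moreover have "(\<Union>i. T i) = UNIV"
    using T(1) by blast
  ultimately show ?thesis
    by metis
qed

lemma base_above:
  fixes f :: "'n::finite set \<Rightarrow> real"
  assumes "submodular f" "y \<in> sub_poly f"
  obtains z where "z \<in> base_poly f" "y \<le> z"
    "(\<forall>A. f A \<in> \<int>) \<Longrightarrow> y \<in> int_vecs \<Longrightarrow> z \<in> int_vecs"
proof -
  obtain z where z: "z \<in> sub_poly f" "y \<le> z" "\<forall>i\<in>UNIV. \<exists>A. i \<in> A \<and> vsum z A = f A"
    "(\<forall>A. f A \<in> \<int>) \<and> y \<in> int_vecs \<longrightarrow> z \<in> int_vecs"
    using sub_poly_raise_coordinates[OF assms(2), of UNIV] by blast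
  have "vsum z UNIV = f UNIV"
    using tight_UNIV[OF assms(1) z(1)] z(3) by blast
  then show thesis
    using z by (intro that[of z]) (auto simp: base_poly_def)
qed

text \<open>Complementation exchanges union and intersection, and the two signs in
  \<open>- dual_fun f A = f (- A) - f UNIV\<close> leave the direction of the inequality
  unchanged.\<close>

lemma submodular_uminus_dual_fun:
  assumes "submodular f"
  shows "submodular (\<lambda>A. - dual_fun f A)"
  unfolding submodular_def
proof (intro conjI allI)
  show "- dual_fun f {} = 0"
    by (simp add: dual_fun_def)
  fix A B :: "'a set"
  have "f (- A \<union> - B) + f (- A \<inter> - B) \<le> f (- A) + f (- B)"
    using assms by (simp add: submodular_def)
  then show "- dual_fun f A + - dual_fun f B \<ge> - dual_fun f (A \<union> B) + - dual_fun f (A \<inter> B)"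
    by (simp add: dual_fun_def)
qed

lemma base_poly_uminus_dual_fun:
  assumes "submodular f" "z \<in> base_poly (\<lambda>A. - dual_fun f A)"
  shows "- z \<in> base_poly f"
proof -
  have N: "vsum z UNIV = - f UNIV"
    using assms by (simp add: base_poly_def dual_fun_def submodular_def)
  \<comment> \<open>At the complement the bound reads
    \<open>vsum z UNIV - vsum z A \<le> f A - f UNIV\<close>; inserting \<open>N\<close> leaves
    \<open>- vsum z A \<le> f A\<close>.\<close>
  have "vsum z (- A) \<le> - dual_fun f (- A)" for A
    using assms(2) by (simp add: base_poly_def sub_poly_def)
  then show ?thesis
    using N by (simp add: base_poly_def sub_poly_def vsum_uminus vsum_Compl dual_fun_def)
qed

lemma base_below:
  fixes f :: "'n::finite set \<Rightarrow> real"
  assumes "submodular f" "y \<in> sup_poly (dual_fun f)"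
  obtains z where "z \<in> base_poly f" "z \<le> y"
    "(\<forall>A. f A \<in> \<int>) \<Longrightarrow> y \<in> int_vecs \<Longrightarrow> z \<in> int_vecs"
proof -
  have "- y \<in> sub_poly (\<lambda>A. - dual_fun f A)"
    using assms(2) by (simp add: sub_poly_def sup_poly_def vsum_uminus)
  then obtain z where z: "z \<in> base_poly (\<lambda>A. - dual_fun f A)" "- y \<le> z"
    "(\<forall>A. - dual_fun f A \<in> \<int>) \<Longrightarrow> - y \<in> int_vecs \<Longrightarrow> z \<in> int_vecs"
    using base_above[OF submodular_uminus_dual_fun[OF assms(1)]] by blast
  show thesis
  proof (rule that[of "- z"])
    show "- z \<in> base_poly f"
      using base_poly_uminus_dual_fun[OF assms(1) z(1)] .
    show "- z \<le> y"
      using z(2) by (simp add: less_eq_vec_def minus_le_iff)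
    show "- z \<in> int_vecs" if "\<forall>A. f A \<in> \<int>" "y \<in> int_vecs"
      using that by (intro uminus_in_int_vecs z(3)) (simp_all add: dual_fun_def uminus_in_int_vecs)
  qed
qed

lemma base_poly_subset_sub_poly: "base_poly f \<subseteq> sub_poly f"
  by (auto simp: base_poly_def)

text \<open>Subtracting the upper bound at \<open>- A\<close> from the equality at
  \<open>UNIV\<close> gives the lower bound at \<open>A\<close>.\<close>

lemma base_poly_subset_sup_poly: "base_poly f \<subseteq> sup_poly (dual_fun f)"
proof
  fix x assume x: "x \<in> base_poly f"
  have "vsum x (- A) \<le> f (- A)" for A
    using x by (simp add: base_poly_def sub_poly_def)
  then show "x \<in> sup_poly (dual_fun f)"
    using x by (simp add: base_poly_def sup_poly_def dual_fun_def vsum_Compl algebra_simps)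
qed

lemma major_sum_mono:
  assumes "\<forall>i. a $ i > 0" "mono \<phi>" "x \<le> y"
  shows "major_sum a b \<phi> x \<le> major_sum a b \<phi> y"
  unfolding major_sum_def using assms
  by (intro sum_mono mult_left_mono monoD[of \<phi>] divide_right_mono)
    (auto simp: less_eq_vec_def less_imp_le)

lemma major_sum_antimono:
  assumes "\<forall>i. a $ i > 0" "antimono \<phi>" "x \<le> y"
  shows "major_sum a b \<phi> y \<le> major_sum a b \<phi> x"
  unfolding major_sum_def using assms
  by (intro sum_mono mult_left_mono antimonoD[of \<phi>] divide_right_mono)
    (auto simp: less_eq_vec_def less_imp_le)

text \<open>Keeping \<open>B\<close> and \<open>C\<close> arbitrary lets the real polyhedra and
  their sets of integral points be treated alike.\<close>

lemma least_weakly_supermajorized_if_dominated: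
  assumes "\<forall>i. a $ i > 0" "least_majorized a b B x" "B \<subseteq> C" "\<forall>y\<in>C. \<exists>z\<in>B. y \<le> z"
  shows "least_weakly_supermajorized a b C x"
  unfolding least_weakly_supermajorized_def weakly_supermajorized_def
proof (intro conjI ballI allI impI)
  show "x \<in> C"
    using assms(2,3) by (auto simp: least_majorized_def)
  fix y and \<phi> :: "real \<Rightarrow> real"
  assume "y \<in> C" and \<phi>: "antimono \<phi> \<and> continuous_on UNIV \<phi> \<and> convex_on UNIV \<phi>"
  then obtain z where z: "z \<in> B" "y \<le> z"
    using assms(4) by blast
  \<comment> \<open>Majorization compares \<open>x\<close> and \<open>z\<close> under every
    continuous convex function, hence under this \<open>\<phi>\<close>.\<close>
  have "major_sum a b \<phi> x \<le> major_sum a b \<phi> z"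
    using assms(2) z(1) \<phi> by (simp add: least_majorized_def majorized_def)
  also have "\<dots> \<le> major_sum a b \<phi> y"
    using major_sum_antimono assms(1) \<phi> z(2) by blast
  finally show "major_sum a b \<phi> x \<le> major_sum a b \<phi> y" .
qed

lemma least_weakly_submajorized_if_dominating:
  assumes "\<forall>i. a $ i > 0" "least_majorized a b B x" "B \<subseteq> C" "\<forall>y\<in>C. \<exists>z\<in>B. z \<le> y"
  shows "least_weakly_submajorized a b C x"
  unfolding least_weakly_submajorized_def weakly_submajorized_def
proof (intro conjI ballI allI impI)
  show "x \<in> C"
    using assms(2,3) by (auto simp: least_majorized_def)
  fix y and \<phi> :: "real \<Rightarrow> real"
  assume "y \<in> C" and \<phi>: "mono \<phi> \<and> continuous_on UNIV \<phi> \<and> convex_on UNIV \<phi>"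
  then obtain z where z: "z \<in> B" "z \<le> y"
    using assms(4) by blast
  have "major_sum a b \<phi> x \<le> major_sum a b \<phi> z"
    using assms(2) z(1) \<phi> by (simp add: least_majorized_def majorized_def)
  also have "\<dots> \<le> major_sum a b \<phi> y"
    using major_sum_mono assms(1) \<phi> z(2) by blast
  finally show "major_sum a b \<phi> x \<le> major_sum a b \<phi> y" .
qed

theorem lemma10:
  fixes f :: "'n::finite set \<Rightarrow> real" and a b :: "real ^ 'n"
  assumes "submodular f" and "\<forall>i. a $ i > 0"
  shows "(\<forall>x. least_majorized a b (base_poly f) x \<longrightarrow>
            least_weakly_supermajorized a b (sub_poly f) x \<and>
            least_weakly_submajorized a b (sup_poly (dual_fun f)) x) \<and>
         ((\<forall>A. f A \<in> \<int>) \<and> b \<in> int_vecs \<longrightarrow>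
           (\<forall>x. least_majorized 1 b (int_base_poly f) x \<longrightarrow>
              least_weakly_supermajorized 1 b (int_sub_poly f) x \<and>
              least_weakly_submajorized 1 b (int_sup_poly (dual_fun f)) x))"
proof (intro conjI allI impI; (elim conjE)?)
  fix x assume x: "least_majorized a b (base_poly f) x"
  have "\<forall>y\<in>sub_poly f. \<exists>z\<in>base_poly f. y \<le> z"
    using base_above[OF assms(1)] by metis
  then show "least_weakly_supermajorized a b (sub_poly f) x"
    using least_weakly_supermajorized_if_dominated[OF assms(2) x base_poly_subset_sub_poly] by blast
  have "\<forall>y\<in>sup_poly (dual_fun f). \<exists>z\<in>base_poly f. z \<le> y"
    using base_below[OF assms(1)] by metis
  then show "least_weakly_submajorized a b (sup_poly (dual_fun f)) x"
    using least_weakly_submajorized_if_dominating[OF assms(2) x base_poly_subset_sup_poly] by blast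
next
  fix x assume f: "\<forall>A. f A \<in> \<int>" and x: "least_majorized 1 b (int_base_poly f) x"
  have one: "\<forall>i. (1 :: real ^ 'n) $ i > 0"
    by simp
  \<comment> \<open>The integrality clause of \<open>base_above\<close> keeps the dominating base
    among the integral points.\<close>
  have "\<forall>y\<in>int_sub_poly f. \<exists>z\<in>int_base_poly f. y \<le> z"
    unfolding int_sub_poly_def int_base_poly_def using base_above[OF assms(1)] f by (metis IntE IntI)
  moreover have "int_base_poly f \<subseteq> int_sub_poly f"
    unfolding int_sub_poly_def int_base_poly_def using base_poly_subset_sub_poly by blast
  ultimately show "least_weakly_supermajorized 1 b (int_sub_poly f) x"
    using least_weakly_supermajorized_if_dominated[OF one x] by blast
  have "\<forall>y\<in>int_sup_poly (dual_fun f). \<exists>z\<in>int_base_poly f. z \<le> y"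
    unfolding int_sup_poly_def int_base_poly_def using base_below[OF assms(1)] f by (metis IntE IntI)
  moreover have "int_base_poly f \<subseteq> int_sup_poly (dual_fun f)"
    unfolding int_sup_poly_def int_base_poly_def using base_poly_subset_sup_poly by blast
  ultimately show "least_weakly_submajorized 1 b (int_sup_poly (dual_fun f)) x"
    using least_weakly_submajorized_if_dominating[OF one x] by blast
qed

end
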